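(* Given any $k\in \mathbb N$, if $G$ is a digraph on $n\geq 2(k+1)$ vertices with $\delta(G)\geq n+\lfloor\frac{n}{k+1}\rfloor-1$, then every strongly connected component $H$ of $G$ has more than $\lfloor\frac{n}{k+1}\rfloor\geq 2$ vertices and satisfies $\delta(H)\geq |V(H)|+\lfloor\frac{n}{k+1}\rfloor-1$. Consequently, $G$ contains a directed $2$-factor with at most $k$ cycles.
   Context: Digraphs have no loops and at most one edge in each direction between any pair of vertices (so both $xy$ and $yx$ may be present). The minimum degree $\delta(G)$ of a digraph $G$ is the minimum, over the vertices $v$, of the number of edges incident to $v$ (in-degree plus out-degree). A digraph is strongly connected if for every ordered pair of distinct vertices $x,y$ there is a directed path from $x$ to $y$; a strongly connected component is a maximal strongly connected (induced) subdigraph. A directed cycle is an oriented graph (a digraph with at most one edge between any pair of vertices) whose underlying graph is a cycle and all of whose edges are oriented in the same direction around the cycle. A directed $2$-factor in a digraph $G$ is a collection of vertex-disjoint directed cycles that together cover all vertices of $G$. $\mathbb N$ denotes the positive integers. *)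

theory Defs
  imports "Graph_Theory.Graph_Theory"
begin

text \<open>
  A digraph in the sense of the locale \<^locale>\<open>digraph\<close> is finite, has no loops, and has at most one
  arc from \<open>u\<close> to \<open>v\<close> for each ordered pair \<open>(u, v)\<close>; both directions may be present.
\<close>

text \<open>Meaningful only for a nonempty finite vertex set, since \<^const>\<open>Min\<close> is unspecified otherwise.\<close>

definition min_degree :: "('a, 'b) pre_digraph \<Rightarrow> nat" where
  "min_degree G = Min ((\<lambda>v. in_degree G v + out_degree G v) ` verts G)"

definition oriented_graph :: "('a, 'b) pre_digraph \<Rightarrow> bool" where
  "oriented_graph G \<longleftrightarrow>
     digraph G \<and> (\<forall>u v. (u, v) \<in> arcs_ends G \<longrightarrow> (v, u) \<notin> arcs_ends G)"

text \<open>
  \<^const>\<open>pre_digraph.cycle\<close> is a nonempty closed arc walk without repeated vertices and by itself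
  allows lengths 1 and 2. Being oriented excludes these, so a directed cycle has at least three
  vertices.
\<close>

definition directed_cycle :: "('a, 'b) pre_digraph \<Rightarrow> bool" where
  "directed_cycle C \<longleftrightarrow>
     oriented_graph C \<and>
     (\<exists>p. pre_digraph.cycle C p \<and> arcs C = set p \<and> verts C = tail C ` set p)"

definition directed_2_factor :: "('a, 'b) pre_digraph set \<Rightarrow> ('a, 'b) pre_digraph \<Rightarrow> bool" where
  "directed_2_factor F G \<longleftrightarrow>
     finite F \<and>
     (\<forall>C\<in>F. subgraph C G \<and> directed_cycle C) \<and>
     pairwise (\<lambda>C D. verts C \<inter> verts D = {}) F \<and>
     (\<Union>C\<in>F. verts C) = verts G"

end

(*
  A vertex outside a strongly connected component H sends at most one edge to each vertex of H, so
  with t = floor(n/(k+1)) every vertex of H has degree at least |V(H)| + t - 1 in H; as this degree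
  is at most 2(|V(H)| - 1), |V(H)| > t. Hence there are at most n/(t+1) < k+1 components,
  and by Ghouila-Houri's theorem each one is Hamiltonian.

  Ghouila-Houri's theorem follows Bondy and Thomassen's proof of Meyniel's theorem. For a longest
  cycle C, take a walk leaving C and returning to it with the shortest possible gap g between its
  ends, and absorb as many gap vertices as possible into the rest of C. If a gap vertex u remains,
  then, by the choice of the gap, no path of length at most 2 through V - C joins u and the first
  vertex s of the walk in either direction; moreover neither u nor s can be inserted into the
  respective path on C. Together this bounds d(s) + d(u) by 2|V| - 2.
*)

theory Submission
  imports Defs
begin

section \<open>Hamiltonian cycles\<close>

text \<open>Summing over \<open>w\<close> gives in-degree plus out-degree of \<open>v\<close>, so
  degree bounds can be split along a partition of the vertex set.\<close>

definition edge_count :: "('a \<Rightarrow> 'a \<Rightarrow> bool) \<Rightarrow> 'a \<Rightarrow> 'a \<Rightarrow> nat" where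
  "edge_count E v w = of_bool (E w v) + of_bool (E v w)"

definition cyclic_list :: "('a \<Rightarrow> 'a \<Rightarrow> bool) \<Rightarrow> 'a list \<Rightarrow> bool" where
  "cyclic_list E xs \<longleftrightarrow> xs \<noteq> [] \<and> distinct xs \<and> successively E xs \<and> E (last xs) (hd xs)"

definition outside :: "('a \<Rightarrow> 'a \<Rightarrow> bool) \<Rightarrow> 'a set \<Rightarrow> 'a \<Rightarrow> 'a \<Rightarrow> bool" where
  "outside E C x y \<longleftrightarrow> E x y \<and> x \<notin> C \<and> y \<notin> C"

text \<open>The interior is a nonempty walk (\<open>s = t\<close> is possible), encoded by
  reachability so that ears can be glued by transitivity. The ends \<open>a\<close> and
  \<open>b\<close> may coincide.\<close>

definition ear :: "('a \<Rightarrow> 'a \<Rightarrow> bool) \<Rightarrow> 'a set \<Rightarrow> 'a \<Rightarrow> 'a \<Rightarrow> bool" where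
  "ear E C a b \<longleftrightarrow> (\<exists>s t. s \<notin> C \<and> t \<notin> C \<and> E a s \<and> (outside E C)\<^sup>*\<^sup>* s t \<and> E t b)"

section \<open>Bounds on edge counts\<close>

lemma edge_count_le_2: "edge_count E v w \<le> 2"
  by (simp add: edge_count_def)

lemma sum_edge_count_le: "finite A \<Longrightarrow> (\<Sum>w\<in>A. edge_count E v w) \<le> 2 * card A"
  using sum_bounded_above[of A "edge_count E v" 2] edge_count_le_2[of E v] by simp

text \<open>For consecutive \<open>x\<close>, \<open>y\<close> at most one of \<open>E x v\<close>
  and \<open>E v y\<close> holds. This gives at most \<open>length xs - 1\<close> edges; only
  \<open>E v (hd xs)\<close> and \<open>E (last xs) v\<close> remain to be added.\<close>

lemma sum_edge_count_noninsertable: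
  assumes "xs \<noteq> []" and "distinct xs"
    and "\<And>ys x y zs. xs = ys @ x # y # zs \<Longrightarrow> \<not> (E x v \<and> E v y)"
  shows "(\<Sum>w\<in>set xs. edge_count E v w) \<le> length xs + 1"
proof -
  \<comment> \<open>The edge from \<open>v\<close> to the head is kept as a separate term: when
    \<open>x\<close> is prepended, it competes with the edge from \<open>x\<close> to
    \<open>v\<close>.\<close>
  have "sum_list (map (edge_count E v) xs) \<le> length xs + of_bool (E v (hd xs))"
    using assms(1,3)
  proof (induction xs rule: list_nonempty_induct)
    case (single x)
    then show ?case by (simp add: edge_count_def)
  next
    case (cons x xs)
    have "\<not> (E x v \<and> E v (hd xs))"
      using cons.prems[of "[]" x "hd xs" "tl xs"] cons.hyps by simp
    moreover have "sum_list (map (edge_count E v) xs) \<le> length xs + of_bool (E v (hd xs))"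
      using cons.prems[of "x # _"] by (intro cons.IH) auto
    moreover have "edge_count E v x = of_bool (E x v) + of_bool (E v x)"
      by (simp add: edge_count_def)
    ultimately show ?case by (auto simp: of_bool_def split: if_splits)
  qed
  also have "\<dots> \<le> length xs + 1" by simp
  finally show ?thesis
    using assms(2) by (simp add: sum_list_distinct_conv_sum_set)
qed

section \<open>Cyclic lists: rotation and insertion\<close>

lemma cyclic_list_rotate: "cyclic_list E (xs @ ys) \<Longrightarrow> cyclic_list E (ys @ xs)"
  by (cases "xs = []"; cases "ys = []")
    (auto simp: cyclic_list_def successively_append_iff)

lemma successively_insert:
  assumes "successively E (ys @ x # y # zs)" "E x v" "E v y"
  shows "successively E (ys @ x # v # y # zs)"
  using assms by (auto simp: successively_append_iff successively_Cons)

lemma cyclic_list_insert: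
  assumes "cyclic_list E (ys @ x # y # zs)" "E x v" "E v y" "v \<notin> set (ys @ x # y # zs)"
  shows "cyclic_list E (ys @ x # v # y # zs)"
  using assms successively_insert[of E ys x y zs v]
  by (cases ys) (auto simp: cyclic_list_def simp del: successively.simps)

text \<open>Rotated to the front, any vertex of the list is the tail of an edge.\<close>

lemma cyclic_list_subset:
  assumes "cyclic_list E xs" and "\<And>x y. E x y \<Longrightarrow> x \<in> V"
  shows "set xs \<subseteq> V"
proof
  fix x assume "x \<in> set xs"
  then obtain us vs where "xs = us @ x # vs" by (meson split_list)
  then have "cyclic_list E (x # vs @ us)"
    using cyclic_list_rotate[of E us "x # vs"] assms(1) by simp
  then show "x \<in> V"
    using assms(2) by (cases "vs @ us") (auto simp: cyclic_list_def)
qed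

section \<open>Paths and ears outside a vertex set\<close>

lemma rtranclp_imp_distinct_path:
  assumes "r\<^sup>*\<^sup>* x y"
  obtains p where "p \<noteq> []" "hd p = x" "last p = y" "distinct p" "successively r p"
  using assms
proof (induction arbitrary: thesis rule: converse_rtranclp_induct)
  case base
  show ?case by (rule base[of "[y]"]) auto
next
  case (step x x')
  obtain p where p: "p \<noteq> []" "hd p = x'" "last p = y" "distinct p" "successively r p"
    using step.IH .
  show ?case
  proof (cases "x \<in> set p")
    case True
    \<comment> \<open>A repeated \<open>x\<close> is short-cut by keeping only the part of
      \<open>p\<close> from \<open>x\<close> on.\<close>
    then obtain us vs where "p = us @ x # vs" by (auto dest: split_list)
    with p show ?thesis
      by (intro step.prems[of "x # vs"]) (auto simp: successively_append_iff)
  next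
    case False
    with p step.hyps show ?thesis
      by (intro step.prems[of "x # p"]) (auto simp: successively_Cons)
  qed
qed

lemma ear_imp_path:
  assumes "ear E C a b"
  obtains p where "p \<noteq> []" "E a (hd p)" "E (last p) b" "distinct p" "successively E p"
    "set p \<inter> C = {}"
proof -
  obtain s t where st: "s \<notin> C" "t \<notin> C" "E a s" "(outside E C)\<^sup>*\<^sup>* s t" "E t b"
    using assms by (auto simp: ear_def)
  obtain p where p: "p \<noteq> []" "hd p = s" "last p = t" "distinct p" "successively (outside E C) p"
    using rtranclp_imp_distinct_path[OF st(4)] .
  \<comment> \<open>Edges of \<open>outside\<close> say nothing about a one-vertex path; there
    \<open>s \<notin> C\<close> is what counts.\<close>
  have "set p \<inter> C = {}"
    using p(1,2,5) st(1)
  proof (induction p arbitrary: s rule: list_nonempty_induct)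
    case (cons x xs)
    then show ?case by (auto simp: successively_Cons outside_def)
  qed auto
  moreover have "successively E p"
    using p(5) by (rule successively_mono) (auto simp: outside_def)
  ultimately show thesis using that p st by blast
qed

text \<open>The last edge of the walk that leaves \<open>C\<close> serves: from \<open>s\<close> on
  the walk stays outside.\<close>

lemma leave_set:
  assumes "E\<^sup>*\<^sup>* x y" "x \<in> C" "y \<notin> C"
  obtains a s where "a \<in> C" "s \<notin> C" "E a s" "(outside E C)\<^sup>*\<^sup>* s y"
  using assms
proof (induction arbitrary: thesis rule: rtranclp_induct)
  case (step y z)
  show ?case
  proof (cases "y \<in> C")
    case True
    then show ?thesis using step by blast
  next
    case False
    then obtain a s where "a \<in> C" "s \<notin> C" "E a s" "(outside E C)\<^sup>*\<^sup>* s y"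
      using step.IH step.prems by blast
    moreover have "outside E C y z"
      using False step by (simp add: outside_def)
    ultimately show ?thesis using step.prems(1) by (meson rtranclp.rtrancl_into_rtrancl)
  qed
qed auto

text \<open>Dually, the first edge that enters \<open>C\<close> serves.\<close>

lemma enter_set:
  assumes "E\<^sup>*\<^sup>* x y" "x \<notin> C" "y \<in> C"
  obtains t b where "b \<in> C" "t \<notin> C" "E t b" "(outside E C)\<^sup>*\<^sup>* x t"
  using assms
proof (induction arbitrary: thesis rule: converse_rtranclp_induct)
  case (step x z)
  show ?case
  proof (cases "z \<in> C")
    case True
    then show ?thesis using step by blast
  next
    case False
    then obtain t b where "b \<in> C" "t \<notin> C" "E t b" "(outside E C)\<^sup>*\<^sup>* z t"
      using step.IH step.prems by blast
    moreover have "outside E C x z"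
      using False step by (simp add: outside_def)
    ultimately show ?thesis using step.prems(1) by (meson converse_rtranclp_into_rtranclp)
  qed
qed auto

text \<open>The last exit on the way to \<open>y\<close> and the first return on the way back are
  joined at \<open>y\<close>.\<close>

lemma ear_exists:
  assumes "E\<^sup>*\<^sup>* x y" "E\<^sup>*\<^sup>* y x" "x \<in> C" "y \<notin> C"
  obtains a b where "a \<in> C" "b \<in> C" "ear E C a b"
proof -
  obtain a s where "a \<in> C" "s \<notin> C" "E a s" "(outside E C)\<^sup>*\<^sup>* s y"
    using leave_set[OF assms(1,3,4)] .
  moreover obtain t b where "b \<in> C" "t \<notin> C" "E t b" "(outside E C)\<^sup>*\<^sup>* y t"
    using enter_set[OF assms(2,4,3)] .
  ultimately show thesis
    using that unfolding ear_def by (meson rtranclp_trans)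
qed

section \<open>Lengthening a cycle by an ear of minimal gap\<close>

text \<open>
  Let \<open>R = q @ [a]\<close> and \<open>b = hd R\<close>.
  If \<open>Q\<close> is a longest path from \<open>b\<close> to \<open>a\<close> with \<open>R \<subseteq> Q \<subseteq> C\<close>, then either \<open>Q\<close> covers \<open>C\<close> and closes
  up with the ear to a longer cycle, or the degrees of the first vertex \<open>s\<close> of the ear and of a
  vertex \<open>u \<in> C - Q\<close> sum to less than \<open>2 |V|\<close>. The case \<open>q = []\<close>, \<open>R = [a]\<close> covers ears with equal ends.
\<close>

lemma longer_cyclic_list:
  assumes fin: "finite V" and in_V: "\<And>x y. E x y \<Longrightarrow> x \<in> V \<and> y \<in> V"
    and irrefl: "\<And>x. \<not> E x x"
    and deg: "\<And>v. v \<in> V \<Longrightarrow> card V \<le> (\<Sum>w\<in>V. edge_count E v w)"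
    and cyc: "cyclic_list E (a # g @ q)" and C: "C = set (a # g @ q)"
    and ear: "ear E C a (hd (q @ [a]))"
    and min: "\<And>a' g' q'. cyclic_list E (a' # g' @ q') \<Longrightarrow> set (a' # g' @ q') = C \<Longrightarrow>
      ear E C a' (hd (q' @ [a'])) \<Longrightarrow> length g \<le> length g'"
  obtains ys where "cyclic_list E ys" "length ys > length (a # g @ q)"
proof (rule ccontr)
  assume "\<not> thesis"
  then have longest: "length ys \<le> length (a # g @ q)" if "cyclic_list E ys" for ys
    using that \<open>\<And>ys. _ \<Longrightarrow> _ \<Longrightarrow> thesis\<close> by fastforce
  \<comment> \<open>The ear from \<open>a\<close> to \<open>b\<close> bypasses the gap
    \<open>g\<close>; \<open>R\<close> is the rest of the cycle, running from \<open>b\<close> to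
    \<open>a\<close>.\<close>
  define R where "R = q @ [a]"
  define b where "b = hd R"
  have dist: "distinct (a # g @ q)" using cyc by (simp add: cyclic_list_def)
  have card_C: "card C = length (a # g @ q)"
    unfolding C by (rule distinct_card[OF dist])
  have C_eq: "C = set g \<union> set R"
    by (auto simp: C R_def)
  have "finite C" by (simp add: C)
  have R: "R \<noteq> []" "distinct R" "successively E R" "last R = a"
    using cyc by (auto simp: R_def cyclic_list_def successively_append_iff successively_Cons)
  have gR: "cyclic_list E (g @ R)"
    using cyclic_list_rotate[of E "[a]" "g @ q"] cyc by (simp add: R_def)
  have C_V: "C \<subseteq> V"
    unfolding C using cyclic_list_subset[OF cyc] in_V by blast
  obtain s t where st: "s \<notin> C" "t \<notin> C" "E a s" "(outside E C)\<^sup>*\<^sup>* s t" "E t b"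
    using ear by (auto simp: ear_def b_def R_def)

  \<comment> \<open>A longest member absorbs as many gap vertices as possible; the vertices of
    \<open>R\<close> may be visited in any order between \<open>b\<close> and
    \<open>a\<close>.\<close>
  define paths where "paths = {Q. distinct Q \<and> Q \<noteq> [] \<and> successively E Q \<and> hd Q = b \<and> last Q = a
    \<and> set R \<subseteq> set Q \<and> set Q \<subseteq> C}"
  have "R \<in> paths" using R C_eq by (auto simp: paths_def b_def)
  have "length Q < Suc (card C)" if "Q \<in> paths" for Q
    using that card_mono[OF \<open>finite C\<close>, of "set Q"] distinct_card[of Q] by (simp add: paths_def)
  then obtain Q where "Q \<in> paths" and Q_max: "\<And>Q'. Q' \<in> paths \<Longrightarrow> length Q' \<le> length Q"
    using ex_has_greatest_nat[of "\<lambda>Q. Q \<in> paths" R length "Suc (card C)"] \<open>R \<in> paths\<close>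
    by blast
  then have Q: "distinct Q" "Q \<noteq> []" "successively E Q" "hd Q = b" "last Q = a"
    "set R \<subseteq> set Q" "set Q \<subseteq> C"
    by (auto simp: paths_def)

  have "C \<noteq> set Q"
  proof
    assume "C = set Q"
    obtain p where p: "p \<noteq> []" "E a (hd p)" "E (last p) b" "distinct p" "successively E p"
      "set p \<inter> C = {}"
      using ear_imp_path[OF ear] by (auto simp: b_def R_def)
    have "cyclic_list E (Q @ p)"
      using Q p \<open>C = set Q\<close> by (auto simp: cyclic_list_def successively_append_iff)
    then have "length (Q @ p) \<le> card C" using longest[of "Q @ p"] card_C by simp
    then show False using \<open>C = set Q\<close> distinct_card[OF Q(1)] p(1) by simp
  qed
  then obtain u where u: "u \<in> C" "u \<notin> set Q" using Q by blast
  then have "u \<in> set g" using C_eq Q by blast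

  \<comment> \<open>With \<open>g = g1 @ c # g2\<close>, an ear from \<open>c\<close> to
    \<open>b\<close> would have gap \<open>g2\<close>, and one from \<open>a\<close> to
    \<open>c\<close> gap \<open>g1\<close>, both shorter than \<open>g\<close>.\<close>
  have no_ear: "\<not> ear E C c b" "\<not> ear E C a c" if "c \<in> set g" for c
  proof -
    obtain g1 g2 where g: "g = g1 @ c # g2" using \<open>c \<in> set g\<close> by (meson split_list)
    have cyc': "cyclic_list E (c # g2 @ (q @ a # g1))" "cyclic_list E (a # g1 @ (c # g2 @ q))"
      using cyclic_list_rotate[of E "a # g1" "c # g2 @ q"] cyc by (simp_all add: g)
    have [simp]: "hd (q @ a # xs) = b" for xs by (cases q) (simp_all add: b_def R_def)
    show "\<not> ear E C c b"
      using min[OF cyc'(1)] by (auto simp: C g)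
    show "\<not> ear E C a c"
      using min[OF cyc'(2)] by (auto simp: C g)
  qed
  \<comment> \<open>An edge from \<open>s\<close> to \<open>c\<close> would complete an ear from
    \<open>a\<close> to \<open>c\<close>; one from \<open>c\<close> to \<open>s\<close> would start
    an ear from \<open>c\<close> to \<open>b\<close>.\<close>
  have no_edge: "edge_count E s c = 0" "edge_count E c s = 0" if "c \<in> set g" for c
    using no_ear[OF that] st by (auto simp: edge_count_def ear_def)
  \<comment> \<open>Going from \<open>u\<close> through \<open>w\<close> to \<open>s\<close> would
    start an ear from \<open>u\<close> to \<open>b\<close>; going from \<open>s\<close> through
    \<open>w\<close> to \<open>u\<close> would complete one from \<open>a\<close> to
    \<open>u\<close>. So each direction contributes at most one edge.\<close>
  have no_path: "edge_count E s w + edge_count E u w \<le> 2" if "w \<notin> C" for w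
  proof -
    have "\<not> (E u w \<and> E w s)"
    proof
      assume "E u w \<and> E w s"
      then have "(outside E C)\<^sup>*\<^sup>* w t"
        using st that by (intro converse_rtranclp_into_rtranclp[OF _ st(4)]) (simp add: outside_def)
      then show False
        using \<open>E u w \<and> E w s\<close> no_ear(1)[OF \<open>u \<in> set g\<close>] st that by (auto simp: ear_def)
    qed
    moreover have "\<not> (E s w \<and> E w u)"
    proof
      assume "E s w \<and> E w u"
      then have "(outside E C)\<^sup>*\<^sup>* s w"
        using st that by (intro r_into_rtranclp) (simp add: outside_def)
      then show False
        using \<open>E s w \<and> E w u\<close> no_ear(2)[OF \<open>u \<in> set g\<close>] st that by (auto simp: ear_def)
    qed
    ultimately show ?thesis by (auto simp: edge_count_def)
  qed

  \<comment> \<open>Inserting \<open>s\<close> into \<open>R\<close> would lengthen the cycle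
    \<open>g @ R\<close>; inserting \<open>u\<close> into \<open>Q\<close> below would contradict
    the choice of \<open>Q\<close>.\<close>
  have s_R: "(\<Sum>w\<in>set R. edge_count E s w) \<le> length R + 1"
  proof (rule sum_edge_count_noninsertable[OF R(1,2)])
    fix ys x y zs assume eq: "R = ys @ x # y # zs"
    show "\<not> (E x s \<and> E s y)"
    proof
      assume "E x s \<and> E s y"
      then have "cyclic_list E ((g @ ys) @ x # s # y # zs)"
        using gR st(1) C_eq eq by (intro cyclic_list_insert) auto
      from longest[OF this] show False using arg_cong[OF eq, of length] by (simp add: R_def)
    qed
  qed
  have u_Q: "(\<Sum>w\<in>set Q. edge_count E u w) \<le> length Q + 1"
  proof (rule sum_edge_count_noninsertable[OF Q(2,1)])
    fix ys x y zs assume eq: "Q = ys @ x # y # zs"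
    show "\<not> (E x u \<and> E u y)"
    proof
      assume "E x u \<and> E u y"
      then have "ys @ x # u # y # zs \<in> paths"
        using Q u eq successively_insert[of E ys x y zs u] by (cases ys) (auto simp: paths_def)
      from Q_max[OF this] show False using eq by simp
    qed
  qed

  define S where "S = V - C"
  have "finite S" "s \<in> S" "s \<in> V" "u \<in> V"
    using fin st in_V C_V u by (auto simp: S_def)
  have V_eq: "V = S \<union> C" "S \<inter> C = {}" using C_V by (auto simp: S_def)
  have split_S: "(\<Sum>w\<in>V. f w) = (\<Sum>w\<in>S. f w) + (\<Sum>w\<in>C. f w)" for f :: "'a \<Rightarrow> nat"
    using V_eq \<open>finite S\<close> \<open>finite C\<close> by (simp add: sum.union_disjoint)
  have S_sum: "(\<Sum>w\<in>S. edge_count E s w + edge_count E u w) \<le> 2 * (card S - 1)"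
  proof -
    \<comment> \<open>The summand at \<open>w = s\<close> vanishes, which improves the bound by
      2.\<close>
    have "edge_count E s s + edge_count E u s = 0"
      using irrefl no_edge(2)[OF \<open>u \<in> set g\<close>] by (simp add: edge_count_def)
    then have "(\<Sum>w\<in>S. edge_count E s w + edge_count E u w)
        = (\<Sum>w\<in>S - {s}. edge_count E s w + edge_count E u w)"
      using \<open>finite S\<close> \<open>s \<in> S\<close> by (simp add: sum.remove)
    also have "\<dots> \<le> of_nat (card (S - {s})) * 2"
      using no_path by (intro sum_bounded_above) (auto simp: S_def)
    finally show ?thesis using \<open>s \<in> S\<close> \<open>finite S\<close> by simp
  qed
  have "(\<Sum>w\<in>C. edge_count E s w) = (\<Sum>w\<in>set R. edge_count E s w)"
    using no_edge C_eq \<open>finite C\<close> by (intro sum.mono_neutral_right) auto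
  then have s_C: "(\<Sum>w\<in>C. edge_count E s w) \<le> length R + 1" using s_R by simp
  have u_C: "(\<Sum>w\<in>C. edge_count E u w) \<le> length Q + 1 + 2 * (card C - length Q - 1)"
  proof -
    have "(\<Sum>w\<in>C. edge_count E u w) =
        (\<Sum>w\<in>set Q. edge_count E u w) + (\<Sum>w\<in>C - set Q. edge_count E u w)"
      using Q \<open>finite C\<close> by (simp add: sum.subset_diff add.commute)
    also have "(\<Sum>w\<in>C - set Q. edge_count E u w) = (\<Sum>w\<in>C - set Q - {u}. edge_count E u w)"
      using u \<open>finite C\<close> irrefl by (simp add: sum.remove[of _ u] edge_count_def)
    also have "\<dots> \<le> 2 * card (C - set Q - {u})"
      using \<open>finite C\<close> by (intro sum_edge_count_le) simp
    also have "card (C - set Q - {u}) = card C - length Q - 1"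
      using u Q \<open>finite C\<close> by (simp add: card_Diff_subset distinct_card)
    finally show ?thesis using u_Q by linarith
  qed
  \<comment> \<open>This and \<open>card S > 0\<close> keep the subtractions from truncating. The
    degrees of \<open>s\<close> and \<open>u\<close> then add up to at most
    \<open>2 * card V - 2 + length R - length Q\<close>, hence to less than
    \<open>2 * card V\<close>.\<close>
  have "card (insert u (set Q)) \<le> card C"
    using u Q \<open>finite C\<close> by (intro card_mono) auto
  then have "length Q + 1 \<le> card C" using u Q by (simp add: distinct_card)
  moreover have "length R \<le> length Q" using Q_max \<open>R \<in> paths\<close> .
  moreover have "card V = card S + card C"
    using V_eq \<open>finite S\<close> \<open>finite C\<close> by (simp add: card_Un_disjoint)
  moreover have "card S > 0"
    using \<open>s \<in> S\<close> \<open>finite S\<close> by (auto simp: card_gt_0_iff)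
  ultimately show False
    using deg[OF \<open>s \<in> V\<close>] deg[OF \<open>u \<in> V\<close>] S_sum s_C u_C
    by (simp add: split_S sum.distrib)
qed

text \<open>This is Ghouila-Houri's theorem.\<close>

lemma hamiltonian_cyclic_list:
  assumes fin: "finite V" and in_V: "\<And>x y. E x y \<Longrightarrow> x \<in> V \<and> y \<in> V"
    and irrefl: "\<And>x. \<not> E x x"
    and deg: "\<And>v. v \<in> V \<Longrightarrow> card V \<le> (\<Sum>w\<in>V. edge_count E v w)"
    and conn: "\<And>x y. x \<in> V \<Longrightarrow> y \<in> V \<Longrightarrow> E\<^sup>*\<^sup>* x y"
    and "card V \<ge> 2"
  obtains xs where "cyclic_list E xs" "set xs = V"
proof -
  have sub: "set xs \<subseteq> V" if "cyclic_list E xs" for xs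
    using cyclic_list_subset[OF that] in_V by blast
  obtain x y where xy: "x \<in> V" "y \<in> V" "x \<noteq> y"
    using \<open>card V \<ge> 2\<close> card_le_Suc0_iff_eq[OF fin] by auto
  \<comment> \<open>An ear from \<open>x\<close> back to \<open>x\<close> closes up to a first
    cyclic list, so that a longest one exists.\<close>
  obtain a b where ab: "a \<in> {x}" "b \<in> {x}" "ear E {x} a b"
    using ear_exists[of E x y "{x}"] conn xy by blast
  then obtain p where "p \<noteq> []" "E x (hd p)" "E (last p) x" "distinct p" "successively E p"
    "set p \<inter> {x} = {}"
    using ear_imp_path[OF ab(3)] by blast
  then have "cyclic_list E (x # p)"
    by (auto simp: cyclic_list_def successively_Cons)
  moreover have "length xs < Suc (card V)" if "cyclic_list E xs" for xs
    using card_mono[OF fin sub[OF that]] that by (simp add: cyclic_list_def distinct_card less_Suc_eq_le)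
  ultimately obtain xs where xs: "cyclic_list E xs"
    and max: "\<And>ys. cyclic_list E ys \<Longrightarrow> length ys \<le> length xs"
    using ex_has_greatest_nat[of "cyclic_list E" "x # p" length "Suc (card V)"] by blast
  have "set xs = V"
  proof (rule ccontr)
    assume "set xs \<noteq> V"
    then obtain v where v: "v \<in> V" "v \<notin> set xs" using sub[OF xs] by blast
    have "hd xs \<in> set xs" using xs by (simp add: cyclic_list_def)
    then obtain a b where ab: "a \<in> set xs" "b \<in> set xs" "ear E (set xs) a b"
      using ear_exists[of E "hd xs" v "set xs"] conn sub[OF xs] v by blast
    \<comment> \<open>All ways to cut a cycle on the same vertices at the ends of an ear, among
      which one with shortest gap \<open>g\<close> is taken.\<close>
    define P where "P = (\<lambda>(a, g, q). cyclic_list E (a # g @ q) \<and> set (a # g @ q) = set xs \<and>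
      ear E (set xs) a (hd (q @ [a])))"
    obtain us vs where split: "xs = us @ a # vs" using ab(1) by (meson split_list)
    then have rot: "cyclic_list E (a # vs @ us)" "set (a # vs @ us) = set xs"
      using cyclic_list_rotate[of E us "a # vs"] xs by auto
    have "\<exists>g q. P (a, g, q)"
    proof (cases "b = a")
      case True
      \<comment> \<open>If the ends coincide, the gap is all of the cycle except \<open>a\<close>,
        and \<open>hd (q @ [a])\<close> is \<open>a\<close> itself.\<close>
      then have "P (a, vs @ us, [])" using rot ab by (simp add: P_def)
      then show ?thesis by blast
    next
      case False
      then have "b \<in> set (vs @ us)" using rot(2) ab(2) by auto
      then obtain g q where "vs @ us = g @ b # q" by (meson split_list)
      then have "P (a, g, b # q)" using rot ab by (simp add: P_def)
      then show ?thesis by blast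
    qed
    then obtain T where "P T" and T_min: "\<And>T'. P T' \<Longrightarrow> length (fst (snd T)) \<le> length (fst (snd T'))"
      using ex_has_least_nat[of P _ "\<lambda>T. length (fst (snd T))"] by blast
    obtain a' g q where T: "T = (a', g, q)" by (cases T)
    have *: "cyclic_list E (a' # g @ q)" "set xs = set (a' # g @ q)"
      "ear E (set xs) a' (hd (q @ [a']))"
      using \<open>P T\<close> by (auto simp: P_def T)
    have "length g \<le> length g'"
      if "cyclic_list E (a' # g' @ q')" "set (a' # g' @ q') = set xs"
        "ear E (set xs) a' (hd (q' @ [a']))" for a' g' q'
      using T_min[of "(a', g', q')"] that by (simp add: P_def T)
    then obtain ys where "cyclic_list E ys" "length ys > length (a' # g @ q)"
      using longer_cyclic_list[OF fin in_V irrefl deg *] by blast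
    moreover have "length (a' # g @ q) = length xs"
      using *(1,2) xs distinct_card unfolding cyclic_list_def by metis
    ultimately show False using max by fastforce
  qed
  with xs show thesis by (rule that)
qed


section \<open>Degrees and strong components\<close>

text \<open>Without parallel arcs, an arc into \<open>v\<close> is determined by its tail, so arcs
  can be counted as in-neighbours.\<close>

lemma (in digraph) in_degree_eq_sum:
  "in_degree G v = (\<Sum>w\<in>verts G. of_bool (w \<rightarrow>\<^bsub>G\<^esub> v))"
proof -
  have "inj_on (tail G) (in_arcs G v)"
    by (auto intro!: inj_onI no_multi_arcs simp: arc_to_ends_def)
  moreover have "tail G ` in_arcs G v = verts G \<inter> {w. w \<rightarrow>\<^bsub>G\<^esub> v}"
    by (auto simp: arcs_ends_conv)
  ultimately show ?thesis
    unfolding in_degree_def by (simp add: card_image[symmetric])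
qed

lemma (in digraph) out_degree_eq_sum:
  "out_degree G v = (\<Sum>w\<in>verts G. of_bool (v \<rightarrow>\<^bsub>G\<^esub> w))"
proof -
  have "inj_on (head G) (out_arcs G v)"
    by (auto intro!: inj_onI no_multi_arcs simp: arc_to_ends_def)
  moreover have "head G ` out_arcs G v = verts G \<inter> {w. v \<rightarrow>\<^bsub>G\<^esub> w}"
    by (auto simp: arcs_ends_conv)
  ultimately show ?thesis
    unfolding out_degree_def by (simp add: card_image[symmetric])
qed

lemma (in digraph) degree_eq_sum_edge_count:
  "in_degree G v + out_degree G v = (\<Sum>w\<in>verts G. edge_count (dominates G) v w)"
  by (simp add: in_degree_eq_sum out_degree_eq_sum edge_count_def sum.distrib)

lemma (in fin_digraph) min_degree_le:
  "v \<in> verts G \<Longrightarrow> min_degree G \<le> in_degree G v + out_degree G v"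
  by (simp add: min_degree_def)

lemma (in fin_digraph) min_degree_geI:
  assumes "verts G \<noteq> {}" and "\<And>v. v \<in> verts G \<Longrightarrow> d \<le> in_degree G v + out_degree G v"
  shows "d \<le> min_degree G"
  using assms by (simp add: min_degree_def)

text \<open>Edges in both directions would make \<open>v\<close> and \<open>w\<close> mutually
  reachable and put \<open>w\<close> into \<open>H\<close>.\<close>

lemma (in wf_digraph) edge_count_outside_scc:
  assumes "H \<in> sccs" "v \<in> verts H" "w \<notin> verts H"
  shows "edge_count (dominates G) v w \<le> 1"
proof -
  have "verts H \<in> sccs_verts" using assms(1) by (auto simp: sccs_verts_conv)
  then have "\<not> (v \<rightarrow>\<^sup>*\<^bsub>G\<^esub> w \<and> w \<rightarrow>\<^sup>*\<^bsub>G\<^esub> v)"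
    using assms by (auto simp: in_sccs_verts_conv_reachable)
  then show ?thesis by (auto simp: edge_count_def)
qed

lemma edge_count_induced_subgraph:
  assumes "induced_subgraph H G" "v \<in> verts H" "w \<in> verts H"
  shows "edge_count (dominates H) v w = edge_count (dominates G) v w"
proof -
  have "x \<rightarrow>\<^bsub>H\<^esub> y \<longleftrightarrow> x \<rightarrow>\<^bsub>G\<^esub> y" if "x \<in> verts H" "y \<in> verts H" for x y
    using assms(1) that
    by (auto simp: induced_subgraph_def subgraph_def compatible_def arcs_ends_conv)
  then show ?thesis using assms by (simp add: edge_count_def)
qed

text \<open>Each vertex outside \<open>H\<close> costs \<open>v\<close> at most one edge. The
  additive form avoids subtraction on \<open>nat\<close>.\<close>

lemma (in digraph) degree_scc:
  assumes H: "H \<in> sccs" "v \<in> verts H"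
  shows "in_degree G v + out_degree G v + card (verts H)
    \<le> in_degree H v + out_degree H v + card (verts G)"
proof -
  have ind: "induced_subgraph H G" using H(1) by (rule in_sccs_imp_induced)
  then have sub: "verts H \<subseteq> verts G" by auto
  interpret H: digraph H using ind by (auto intro: digraph_subgraph)
  have "in_degree G v + out_degree G v = (\<Sum>w\<in>verts G - verts H. edge_count (dominates G) v w)
      + (\<Sum>w\<in>verts H. edge_count (dominates G) v w)"
    unfolding degree_eq_sum_edge_count using sub by (simp add: sum.subset_diff)
  also have "(\<Sum>w\<in>verts H. edge_count (dominates G) v w) = in_degree H v + out_degree H v"
    unfolding H.degree_eq_sum_edge_count
    using edge_count_induced_subgraph[OF ind H(2)] by simp
  also have "(\<Sum>w\<in>verts G - verts H. edge_count (dominates G) v w) \<le> card (verts G - verts H)"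
    using sum_bounded_above[of "verts G - verts H" "edge_count (dominates G) v" 1]
      edge_count_outside_scc[OF H] by simp
  also have "card (verts G - verts H) = card (verts G) - card (verts H)"
    using sub by (simp add: card_Diff_subset)
  finally show ?thesis using card_mono[OF finite_verts sub] by linarith
qed

text \<open>Set against the lower degree bound in a component, this forces the component to be
  large.\<close>

lemma (in digraph) degree_le:
  assumes "v \<in> verts G"
  shows "in_degree G v + out_degree G v \<le> 2 * (card (verts G) - 1)"
proof -
  have "edge_count (dominates G) v v = 0"
    using adj_not_same by (auto simp: edge_count_def)
  then have "in_degree G v + out_degree G v = (\<Sum>w\<in>verts G - {v}. edge_count (dominates G) v w)"
    unfolding degree_eq_sum_edge_count using assms by (simp add: sum.remove)
  also have "\<dots> \<le> 2 * card (verts G - {v})" by (simp add: sum_edge_count_le)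
  finally show ?thesis using assms by simp
qed

section \<open>From vertex lists to directed cycles\<close>

lemma (in wf_digraph) walk_of_vertex_list:
  assumes "xs \<noteq> []" "successively (dominates G) xs"
  obtains p where "set p \<subseteq> arcs G" "cas (hd xs) p (last xs)" "awalk_verts (hd xs) p = xs"
    "map (tail G) p = butlast xs" "map (head G) p = tl xs"
  using assms
proof (induction xs arbitrary: thesis rule: list_nonempty_induct)
  case (single x)
  \<comment> \<open>A lone \<open>x\<close> need not be a vertex of \<open>G\<close>, hence
    \<open>cas\<close> and not \<open>awalk\<close> in the conclusion.\<close>
  show ?case by (rule single.prems(1)[of "[]"]) auto
next
  case (cons x xs)
  then obtain p where p: "set p \<subseteq> arcs G" "cas (hd xs) p (last xs)" "awalk_verts (hd xs) p = xs"
    "map (tail G) p = butlast xs" "map (head G) p = tl xs"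
    by (auto simp: successively_Cons)
  moreover obtain e where "e \<in> arcs G" "tail G e = x" "head G e = hd xs"
    using cons.prems(2) cons.hyps by (auto simp: successively_Cons)
  ultimately show ?case
    using cons.hyps by (intro cons.prems(1)[of "e # p"]) auto
qed

lemma (in digraph) directed_cycle_of_cyclic_list:
  assumes cyc: "cyclic_list (dominates G) xs" and len: "length xs \<ge> 3"
  obtains C where "subgraph C G" "directed_cycle C" "verts C = set xs"
proof -
  \<comment> \<open>Repeating the head turns the closing edge into an ordinary step of the
    walk.\<close>
  define ys where "ys = xs @ [hd xs]"
  have xs: "xs \<noteq> []" "distinct xs" using cyc by (auto simp: cyclic_list_def)
  have "successively (dominates G) ys" "ys \<noteq> []"
    using cyc by (auto simp: cyclic_list_def ys_def successively_append_iff)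
  then obtain p where p: "set p \<subseteq> arcs G" "cas (hd ys) p (last ys)" "awalk_verts (hd ys) p = ys"
    "map (tail G) p = butlast ys" "map (head G) p = tl ys"
    using walk_of_vertex_list by blast
  have tails: "map (tail G) p = xs" using p(4) by (simp add: ys_def)
  have heads: "map (head G) p = rotate1 xs" using p(5) xs by (cases xs) (simp_all add: ys_def)
  \<comment> \<open>Only the arcs of \<open>p\<close> are kept; the subgraph induced on
    \<open>set xs\<close> could contain chords and opposite arcs.\<close>
  define C where "C = \<lparr>verts = set xs, arcs = set p, tail = tail G, head = head G\<rparr>"
  have C_simps [simp]: "verts C = set xs" "arcs C = set p" "tail C = tail G" "head C = head G"
    by (simp_all add: C_def)
  have tail_set: "tail G ` set p = set xs"
    using arg_cong[OF tails, of set] by simp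
  have head_set: "head G ` set p = set xs"
    using arg_cong[OF heads, of set] by simp
  have sub: "subgraph C G"
  proof (rule subgraphI)
    show "verts C \<subseteq> verts G" using p(1) by (auto simp flip: tail_set)
    show "wf_digraph C" using tail_set head_set by unfold_locales auto
  qed (use p(1) in \<open>auto simp: compatible_def wf_digraph\<close>)
  interpret C: digraph C using sub by (rule digraph_subgraph)
  have ends: "\<exists>i<length xs. u = xs ! i \<and> v = xs ! (Suc i mod length xs)"
    if uv: "(u, v) \<in> arcs_ends C" for u v
  proof -
    obtain e where "e \<in> set p" "u = tail G e" "v = head G e"
      using uv by (auto simp: arcs_ends_conv)
    moreover then obtain i where "i < length p" "e = p ! i" by (auto simp: in_set_conv_nth)
    moreover have "length p = length xs" using arg_cong[OF tails, of length] by simp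
    ultimately show ?thesis
      using arg_cong[OF tails, of "\<lambda>l. l ! i"] arg_cong[OF heads, of "\<lambda>l. l ! i"]
      by (auto simp: nth_rotate1)
  qed
  \<comment> \<open>Opposite arcs at positions \<open>i\<close> and \<open>j\<close> would make each
    the cyclic successor of the other, which is impossible in length at least 3.\<close>
  have "(v, u) \<notin> arcs_ends C" if uv: "(u, v) \<in> arcs_ends C" for u v
  proof
    assume vu: "(v, u) \<in> arcs_ends C"
    obtain i j where ij: "i < length xs" "j < length xs" "xs ! i = xs ! (Suc j mod length xs)"
      "xs ! j = xs ! (Suc i mod length xs)"
      using ends[OF uv] ends[OF vu] by auto
    then have "i = Suc j mod length xs" "j = Suc i mod length xs"
      using xs by (simp_all add: nth_eq_iff_index_eq)
    moreover have "Suc m mod length xs = (if Suc m = length xs then 0 else Suc m)"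
      if "m < length xs" for m
      using that by (simp add: mod_Suc)
    ultimately show False
      using ij(1,2) len by (auto split: if_splits)
  qed
  then have "oriented_graph C"
    by (simp add: oriented_graph_def C.digraph_axioms)
  moreover have "C.cycle p"
  proof -
    have "compatible C G" by (simp add: compatible_def)
    moreover have "hd ys = hd xs" "last ys = hd xs" "hd xs \<in> set xs"
      using xs by (simp_all add: ys_def)
    moreover have "p \<noteq> []" using tails xs by auto
    moreover have "distinct (tl ys)" using xs by (cases xs) (auto simp: ys_def)
    ultimately show ?thesis
      using p unfolding C.cycle_def C.awalk_def
      by (intro exI[of _ "hd xs"]) (auto simp: compatible_cas compatible_awalk_verts)
  qed
  ultimately have "directed_cycle C"
    using tail_set by (auto simp: directed_cycle_def)
  then show thesis by (rule that[OF sub _ C_simps(1)])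
qed

lemma (in digraph) strongly_connected_imp_spanning_directed_cycle:
  assumes sc: "strongly_connected G" and "card (verts G) \<ge> 3"
    and "min_degree G \<ge> card (verts G)"
  obtains C where "subgraph C G" "directed_cycle C" "verts C = verts G"
proof -
  have conn: "(dominates G)\<^sup>*\<^sup>* x y" if "x \<in> verts G" "y \<in> verts G" for x y
  proof -
    have "(x, y) \<in> (arcs_ends G)\<^sup>*"
      using sc that reachable_conv by (auto simp: strongly_connected_def)
    then show ?thesis by (simp add: rtrancl_def)
  qed
  have deg: "card (verts G) \<le> (\<Sum>w\<in>verts G. edge_count (dominates G) v w)"
    if "v \<in> verts G" for v
    using min_degree_le[OF that] assms(3) by (simp add: degree_eq_sum_edge_count)
  obtain xs where xs: "cyclic_list (dominates G) xs" "set xs = verts G"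
  proof (rule hamiltonian_cyclic_list[OF finite_verts _ _ deg conn])
    show "x \<in> verts G \<and> y \<in> verts G" if "x \<rightarrow>\<^bsub>G\<^esub> y" for x y
      using adj_in_verts[OF that] by simp
    show "\<not> x \<rightarrow>\<^bsub>G\<^esub> x" for x
      using adj_not_same by blast
    show "card (verts G) \<ge> 2"
      using assms(2) by simp
  qed
  then have "length xs \<ge> 3"
    using assms(2) by (metis cyclic_list_def distinct_card)
  then show thesis using directed_cycle_of_cyclic_list[OF xs(1)] that xs(2) by metis
qed

section \<open>Partition into components and number of cycles\<close>

lemma (in digraph) sccs_partition:
  shows "finite sccs" and "(\<Union>H\<in>sccs. verts H) = verts G"
    and "\<And>H K. H \<in> sccs \<Longrightarrow> K \<in> sccs \<Longrightarrow> H \<noteq> K \<Longrightarrow> verts H \<inter> verts K = {}"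
proof -
  \<comment> \<open>As \<open>verts\<close> is injective on \<open>sccs\<close>, it suffices that
    the vertex sets of components are finite in number.\<close>
  show "finite sccs"
    using finite_imageD[OF _ inj_on_verts_sccs] finite_verts
    by (simp flip: sccs_verts_conv add: sccs_verts_conv_scc_of)
  show "(\<Union>H\<in>sccs. verts H) = verts G"
  proof
    show "(\<Union>H\<in>sccs. verts H) \<subseteq> verts G" by (auto dest!: in_sccs_imp_induced)
    show "verts G \<subseteq> (\<Union>H\<in>sccs. verts H)"
    proof
      fix v assume "v \<in> verts G"
      then have "v \<in> scc_of v" "scc_of v \<in> verts ` sccs"
        by (simp_all add: in_scc_of_self scc_of_in_sccs_verts flip: sccs_verts_conv)
      then show "v \<in> (\<Union>H\<in>sccs. verts H)" by auto
    qed
  qed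
  show "verts H \<inter> verts K = {}" if "H \<in> sccs" "K \<in> sccs" "H \<noteq> K" for H K
    using that inj_onD[OF inj_on_verts_sccs, of H K]
    by (intro sccs_verts_disjoint) (auto simp: sccs_verts_conv)
qed

theorem mainTheorem6:
  fixes G :: "('a, 'b) pre_digraph" and k n :: nat
  assumes "k \<ge> 1"
    and "digraph G"
    and "card (verts G) = n"
    and "n \<ge> 2 * (k + 1)"
    and "min_degree G \<ge> n + n div (k + 1) - 1"
  shows "n div (k + 1) \<ge> 2 \<and>
    (\<forall>H \<in> pre_digraph.sccs G.
        card (verts H) > n div (k + 1) \<and>
        min_degree H \<ge> card (verts H) + n div (k + 1) - 1) \<and>
    (\<exists>F. directed_2_factor F G \<and> card F \<le> k)"
proof -
  interpret digraph G by (rule assms(2))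
  define t where "t = n div (k + 1)"
  have t: "t \<ge> 2"
    unfolding t_def using assms(4) by (subst less_eq_div_iff_mult_less_eq) auto
  have scc: "card (verts H) > t \<and> min_degree H \<ge> card (verts H) + t - 1" if H: "H \<in> sccs" for H
  proof -
    have ind: "induced_subgraph H G" using H by (rule in_sccs_imp_induced)
    interpret H: digraph H using ind by (auto intro: digraph_subgraph)
    have ne: "verts H \<noteq> {}" using H by (auto simp: strongly_connected_def)
    have deg: "card (verts H) + t - 1 \<le> in_degree H v + out_degree H v" if "v \<in> verts H" for v
    proof -
      have "v \<in> verts G" using ind that by auto
      then show ?thesis
        using min_degree_le[of v] degree_scc[OF H that] assms(3,5) t unfolding t_def by linarith
    qed
    obtain v where "v \<in> verts H" using ne by blast
    then have "card (verts H) > 0" by (auto simp: card_gt_0_iff)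
    then have "card (verts H) > t"
      using deg[OF \<open>v \<in> verts H\<close>] H.degree_le[OF \<open>v \<in> verts H\<close>] t by linarith
    then show ?thesis using H.min_degree_geI[OF ne deg] by simp
  qed
  have "\<exists>C. subgraph C G \<and> directed_cycle C \<and> verts C = verts H" if H: "H \<in> sccs" for H
  proof -
    have ind: "subgraph H G" "strongly_connected H" using H by (auto simp: induced_subgraph_def)
    interpret H: digraph H using ind by (auto intro: digraph_subgraph)
    \<comment> \<open>Since \<open>t \<ge> 2\<close>, the component has at least 3 vertices and its
      minimum degree is at least its order.\<close>
    obtain C where "subgraph C H" "directed_cycle C" "verts C = verts H"
      using H.strongly_connected_imp_spanning_directed_cycle[OF ind(2)] scc[OF H] t by force
    then show ?thesis using subgraph_trans ind(1) by blast
  qed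
  then obtain c where c: "\<And>H. H \<in> sccs \<Longrightarrow>
      subgraph (c H) G \<and> directed_cycle (c H) \<and> verts (c H) = verts H"
    by metis
  have "verts (c H) \<inter> verts (c K) = {}" if "H \<in> sccs" "K \<in> sccs" "c H \<noteq> c K" for H K
    using c that sccs_partition(3)[of H K] by auto
  then have "directed_2_factor (c ` sccs) G"
    using c sccs_partition(1,2) by (auto simp: directed_2_factor_def pairwise_image pairwise_def)
  moreover have "card (c ` sccs) \<le> k"
  proof -
    \<comment> \<open>Disjoint components with at least \<open>t + 1\<close> vertices each fit into
      \<open>n < (k + 1) * (t + 1)\<close> vertices.\<close>
    have "card sccs * (t + 1) \<le> (\<Sum>H\<in>sccs. card (verts H))"
      using sum_bounded_below[of sccs "t + 1" "\<lambda>H. card (verts H)"] scc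
      by (simp add: Suc_le_eq)
    also have "\<dots> = n"
    proof -
      have "finite (verts H)" if "H \<in> sccs" for H
        using sccs_partition(2) that by (intro finite_subset[OF _ finite_verts]) auto
      then show ?thesis
        using card_UN_disjoint[OF sccs_partition(1), of verts] sccs_partition(2,3) assms(3)
        by simp
    qed
    also have "n < (k + 1) * (t + 1)"
      unfolding t_def using dividend_less_times_div[of "k + 1" n] by simp
    finally have "card sccs < k + 1" by (simp only: mult_less_cancel2)
    then show ?thesis using card_image_le[OF sccs_partition(1), of c] by linarith
  qed
  ultimately show ?thesis
    using t scc unfolding t_def by blast
qed

end
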